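(* Let $(\Omega,\mathcal F,\mu)$ be a probability space, $\Gamma$ a difference operator on a class $\mathcal A$ of bounded measurable functions on $\Omega$, and assume that $\mu$ satisfies a $\Gamma\mathrm{-mLSI}(\rho)$ for some $\rho>0$. Let $f\in\mathcal A$ and let $g:\Omega\to\mathbb R$ be measurable such that $\Gamma(f)\le g$ and such that for some $c>0$, $C\ge1$ and $K>0$ $$\mu(g\ge c+t)\le C\exp\Big(-\frac{t^2}{2K^2}\Big)\qquad\text{for all }t\ge0.$$ Then for all $t\ge0$ $$\mu\big(f-\mathbb E_\mu f\ge t\big)\le\frac{4C}{3}\exp\Big(-\frac{t^2}{8(\rho c^2+\sqrt\rho K t)}\Big).$$ If moreover $ah\in\mathcal A$ and $\Gamma(ah)=|a|\Gamma(h)$ for all $h\in\mathcal A$ and $a\in\mathbb R$, then the same bound holds with $f$ replaced by $-f$, i.e. for $\mu(\mathbb E_\mu f-f\ge t)$.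
   Context: An operator $\Gamma$ on a class $\mathcal A$ of bounded measurable functions on a probability space $(\Omega,\mathcal F,\mu)$ is called a difference operator if (1) for all $f\in\mathcal A$, $\Gamma(f)$ is a non-negative measurable function; (2) for all $f\in\mathcal A$, $a\ge0$, $b\in\mathbb R$ we have $af+b\in\mathcal A$ and $\Gamma(af+b)=a\Gamma(f)$. No chain rule is assumed. $\mathbb E_\mu$ denotes expectation with respect to $\mu$, and for $h\ge0$, $\mathrm{Ent}_\mu(h)=\mathbb E_\mu h\log h-\mathbb E_\mu h\,\log(\mathbb E_\mu h)$. $\mu$ satisfies a $\Gamma\mathrm{-mLSI}(\rho)$, $\rho>0$, if $\mathrm{Ent}_\mu(e^f)\le\frac\rho2\,\mathbb E_\mu\big(\Gamma(f)^2e^f\big)$ for all $f\in\mathcal A$. *)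

theory Defs
  imports "HOL-Probability.Probability"
begin

text \<open>
  Functions on \<open>\<Omega> = space M\<close> are represented by functions on the whole type; every condition
  on them only refers to their values on \<open>space M\<close>.
\<close>

definition difference_operator ::
    "'a measure \<Rightarrow> ('a \<Rightarrow> real) set \<Rightarrow> (('a \<Rightarrow> real) \<Rightarrow> 'a \<Rightarrow> real) \<Rightarrow> bool" where
  "difference_operator M \<A> \<Gamma> \<longleftrightarrow>
     (\<forall>f\<in>\<A>. f \<in> borel_measurable M \<and> bounded (f ` space M)) \<and>
     (\<forall>f\<in>\<A>. \<Gamma> f \<in> borel_measurable M \<and> (\<forall>x\<in>space M. 0 \<le> \<Gamma> f x)) \<and>
     (\<forall>f\<in>\<A>. \<forall>a\<ge>0. \<forall>b.
        (\<lambda>x. a * f x + b) \<in> \<A> \<and>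
        (\<forall>x\<in>space M. \<Gamma> (\<lambda>x. a * f x + b) x = a * \<Gamma> f x))"

text \<open>
  The Bochner integrals below have the intended meaning when \<open>h\<close> and \<open>h log h\<close> are integrable.
  This holds for \<open>h = exp f\<close> with \<open>f\<close> bounded and measurable, the only case needed.
  The convention \<open>0 log 0 = 0\<close> is automatic.
\<close>

definition Ent :: "'a measure \<Rightarrow> ('a \<Rightarrow> real) \<Rightarrow> real" where
  "Ent M h = (LINT x|M. h x * ln (h x)) - (LINT x|M. h x) * ln (LINT x|M. h x)"

text \<open>
  \<open>\<Gamma> f\<close> need not be bounded, so the right-hand side may be infinite (and the inequality void).
  It is therefore an integral with values in \<open>[0, \<infinity>]\<close>; a Bochner integral would be \<open>0\<close> in that
  case. Applying \<open>ennreal\<close> to the entropy loses nothing, as the entropy is non-negative by Jensen's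
  inequality.
\<close>

definition mLSI ::
    "'a measure \<Rightarrow> ('a \<Rightarrow> real) set \<Rightarrow> (('a \<Rightarrow> real) \<Rightarrow> 'a \<Rightarrow> real) \<Rightarrow> real \<Rightarrow> bool" where
  "mLSI M \<A> \<Gamma> \<rho> \<longleftrightarrow>
     (\<forall>f\<in>\<A>. ennreal (Ent M (\<lambda>x. exp (f x)))
        \<le> ennreal (\<rho> / 2) * (\<integral>\<^sup>+ x. ennreal ((\<Gamma> f x)\<^sup>2 * exp (f x)) \<partial>M))"

end

theory Submission
  imports Defs
begin

text \<open>
  Let \<open>X = f - E f\<close>. The inequality of Bobkov and Goetze \<open>E exp X \<le> E exp (\<rho> g\<^sup>2)\<close> is Herbst's
  argument: by duality of entropy, \<open>E (U e\<^sup>F) \<le> Ent (e\<^sup>F) + E e\<^sup>F log E e\<^sup>U\<close>; for \<open>F = \<lambda> f\<close>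
  and \<open>U = \<rho> g\<^sup>2\<close> the mLSI absorbs the entropy on the right and bounds the derivative of
  \<open>\<lambda> \<mapsto> log (E e\<^sup>F) / \<lambda>\<close> by \<open>log E e\<^sup>U\<close>.
  As \<open>\<Gamma>\<close> is positively homogeneous, the inequality applies to \<open>\<lambda> f\<close> and \<open>\<lambda> g\<close>. With
  \<open>W = max 0 (g - c)\<close> we have \<open>g\<^sup>2 \<le> 2 c\<^sup>2 + 2 W\<^sup>2\<close>, and the tail bound gives
  \<open>E exp (W\<^sup>2 / (8 K\<^sup>2)) \<le> 1 + C / 3 \<le> 4 C / 3\<close>. So
  \<open>E exp (\<lambda> X) \<le> 4 C / 3 * exp (2 \<lambda>\<^sup>2 \<rho> c\<^sup>2)\<close> as long as \<open>2 \<lambda>\<^sup>2 \<rho> \<le> 1 / (8 K\<^sup>2)\<close>, and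
  \<open>\<lambda> = t / (4 (\<rho> c\<^sup>2 + sqrt \<rho> K t))\<close> in Markov's inequality gives the claim.
\<close>

section \<open>Exponential moments of bounded functions and their derivative in the
  parameter\<close>

text \<open>The Lagrange remainder at 0 is \<open>exp t / 2 * x^2\<close> with \<open>t\<close>
  between -B and B. The constant depends on \<open>B\<close> only, which gives an error uniform over
  the probability space when differentiating under the integral.\<close>

lemma abs_exp_minus_one_minus_le:
  fixes x :: real
  assumes "\<bar>x\<bar> \<le> B"
  shows "\<bar>exp x - 1 - x\<bar> \<le> exp B * x\<^sup>2"
proof -
  obtain t where t: "\<bar>t\<bar> \<le> \<bar>x\<bar>" "exp x = (\<Sum>m<2. x ^ m / fact m) + exp t / fact 2 * x ^ 2"
    using Maclaurin_exp_le by blast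
  have e: "exp x - 1 - x = exp t / 2 * x\<^sup>2"
    using t(2) by (simp add: eval_nat_numeral)
  have "exp t / 2 * x\<^sup>2 \<le> exp B * x\<^sup>2"
  proof (rule mult_right_mono)
    have "exp t \<le> exp B" using t(1) assms by simp
    moreover have "exp t > 0" by simp
    ultimately show "exp t / 2 \<le> exp B" by linarith
  qed simp
  then show ?thesis unfolding e by simp
qed

context prob_space
begin

lemma integrable_bounded:
  fixes f :: "'a \<Rightarrow> real"
  assumes "f \<in> borel_measurable M" "\<And>x. x \<in> space M \<Longrightarrow> \<bar>f x\<bar> \<le> B"
  shows "integrable M f"
  using assms by (intro integrable_const_bound[where B = B]) auto

lemma integrable_exp_bounded:
  fixes f :: "'a \<Rightarrow> real"
  assumes "f \<in> borel_measurable M" "\<And>x. x \<in> space M \<Longrightarrow> \<bar>f x\<bar> \<le> B"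
  shows "integrable M (\<lambda>x. exp (f x))"
proof (rule integrable_bounded)
  show "\<bar>exp (f x)\<bar> \<le> exp B" if "x \<in> space M" for x
    using assms(2)[OF that] by auto
qed (use assms(1) in measurable)

lemma expectation_exp_pos:
  fixes f :: "'a \<Rightarrow> real"
  assumes "integrable M (\<lambda>x. exp (f x))"
  shows "0 < expectation (\<lambda>x. exp (f x))"
proof -
  have "expectation (\<lambda>x. exp (f x)) \<noteq> 0"
  proof
    assume "expectation (\<lambda>x. exp (f x)) = 0"
    then have "AE x in M. exp (f x) = 0"
      using integral_nonneg_eq_0_iff_AE[OF assms] by simp
    then have "AE x in M. False" by simp
    then show False by simp
  qed
  moreover have "0 \<le> expectation (\<lambda>x. exp (f x))" by simp
  ultimately show ?thesis by linarith
qed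

text \<open>Since \<open>f\<close> is bounded, the second order Taylor remainder of the exponential
  is uniform in \<open>x\<close>. Integrating it shows that the difference quotient differs from the
  claimed derivative by at most a multiple of \<open>\<bar>h\<bar>\<close>.\<close>

lemma has_derivative_mgf:
  fixes f :: "'a \<Rightarrow> real"
  assumes f [measurable]: "f \<in> borel_measurable M"
    and B: "\<And>x. x \<in> space M \<Longrightarrow> \<bar>f x\<bar> \<le> B"
  shows "((\<lambda>u. expectation (\<lambda>x. exp (u * f x))) has_real_derivative
           expectation (\<lambda>x. f x * exp (u * f x))) (at u)"
proof -
  let ?\<phi> = "\<lambda>u. expectation (\<lambda>x. exp (u * f x))"
  let ?D = "expectation (\<lambda>x. f x * exp (u * f x))"
  \<comment> \<open>The first factor bounds \<open>exp (u * f x)\<close>. The second bounds the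
    remainder of \<open>exp (h * f x)\<close> divided by \<open>h^2\<close>, where
    \<open>\<bar>h\<bar> \<le> 1\<close> keeps \<open>\<bar>h * f x\<bar>\<close> below
    \<open>B\<close>.\<close>
  define L where "L = exp (\<bar>u\<bar> * B) * (exp B * B\<^sup>2)"
  have B0: "0 \<le> B" using B not_empty by fastforce
  have uB: "\<bar>v * f x\<bar> \<le> \<bar>v\<bar> * B" if "x \<in> space M" for x v
    using B[OF that] by (simp add: abs_mult mult_left_mono)
  have i1: "integrable M (\<lambda>x. exp (v * f x))" for v
    by (rule integrable_exp_bounded[where B = "\<bar>v\<bar> * B"]) (auto intro: uB)
  have i2: "integrable M (\<lambda>x. f x * exp (u * f x))"
  proof (rule integrable_bounded)
    show "\<bar>f x * exp (u * f x)\<bar> \<le> B * exp (\<bar>u\<bar> * B)" if "x \<in> space M" for x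
      unfolding abs_mult using B[OF that] uB[OF that, of u] B0 by (intro mult_mono) auto
  qed measurable
  have key: "\<bar>(?\<phi> (u + h) - ?\<phi> u) / h - ?D\<bar> \<le> L * \<bar>h\<bar>" if h: "h \<noteq> 0" "\<bar>h\<bar> \<le> 1" for h
  proof -
    have "\<bar>?\<phi> (u + h) - ?\<phi> u - h * ?D\<bar>
        = \<bar>expectation (\<lambda>x. exp ((u + h) * f x) - exp (u * f x) - h * (f x * exp (u * f x)))\<bar>"
      using i1 i2 by simp
    also have "\<dots> \<le> expectation (\<lambda>x. \<bar>exp ((u + h) * f x) - exp (u * f x) - h * (f x * exp (u * f x))\<bar>)"
      by (rule integral_abs_bound)
    also have "\<dots> \<le> expectation (\<lambda>x. L * h\<^sup>2)"
    proof (rule integral_mono)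
      show "integrable M (\<lambda>x. \<bar>exp ((u + h) * f x) - exp (u * f x) - h * (f x * exp (u * f x))\<bar>)"
        using i1 i2 by (intro integrable_abs Bochner_Integration.integrable_diff integrable_mult_right)
      fix x assume x: "x \<in> space M"
      have hB: "\<bar>h * f x\<bar> \<le> B"
        using uB[OF x, of h] mult_right_mono[OF h(2) B0] by linarith
      have e: "exp ((u + h) * f x) - exp (u * f x) - h * (f x * exp (u * f x))
          = exp (u * f x) * (exp (h * f x) - 1 - h * f x)"
        by (simp add: algebra_simps exp_add)
      have "\<bar>exp (u * f x) * (exp (h * f x) - 1 - h * f x)\<bar>
          \<le> exp (\<bar>u\<bar> * B) * (exp B * (h * f x)\<^sup>2)"
        unfolding abs_mult using uB[OF x, of u] abs_exp_minus_one_minus_le[OF hB]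
        by (intro mult_mono) auto
      also have "\<dots> \<le> exp (\<bar>u\<bar> * B) * (exp B * (h\<^sup>2 * B\<^sup>2))"
        using B[OF x] B0 by (auto simp: power_mult_distrib intro!: mult_left_mono abs_le_square_iff[THEN iffD1])
      finally show "\<bar>exp ((u + h) * f x) - exp (u * f x) - h * (f x * exp (u * f x))\<bar> \<le> L * h\<^sup>2"
        unfolding e L_def by (simp add: mult_ac)
    qed auto
    finally have *: "\<bar>?\<phi> (u + h) - ?\<phi> u - h * ?D\<bar> \<le> L * h\<^sup>2"
      by (simp add: prob_space)
    have "\<bar>(?\<phi> (u + h) - ?\<phi> u) / h - ?D\<bar> = \<bar>?\<phi> (u + h) - ?\<phi> u - h * ?D\<bar> / \<bar>h\<bar>"
      using h(1) by (simp add: field_simps flip: abs_divide)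
    also have "\<dots> \<le> L * h\<^sup>2 / \<bar>h\<bar>"
      using * by (rule divide_right_mono) simp
    also have "\<dots> = L * \<bar>h\<bar>"
      using h(1) by (simp add: field_simps power2_eq_square)
    finally show ?thesis .
  qed
  have "((\<lambda>h. (?\<phi> (u + h) - ?\<phi> u) / h - ?D) \<longlongrightarrow> 0) (at 0)"
  proof (rule Lim_null_comparison)
    show "\<forall>\<^sub>F h in at 0. norm ((?\<phi> (u + h) - ?\<phi> u) / h - ?D) \<le> L * \<bar>h\<bar>"
      unfolding eventually_at real_norm_def using key by (intro exI[of _ 1]) auto
    show "((\<lambda>h. L * \<bar>h\<bar>) \<longlongrightarrow> 0) (at 0)"
      by (auto intro!: tendsto_eq_intros)
  qed
  then show ?thesis
    unfolding DERIV_def by (simp add: LIM_zero_iff)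
qed

section \<open>Duality for entropy and Herbst's argument\<close>

text \<open>This is the non-negativity of the relative entropy of the density proportional to
  \<open>exp F\<close> with respect to the one proportional to \<open>exp U\<close>. It follows by
  integrating the pointwise inequality \<open>1 + w \<le> exp w\<close>. \<open>U\<close> may be
  unbounded, as \<open>g\<close> will be; its exponential integrability suffices.\<close>

lemma Ent_exp_duality:
  fixes F U :: "'a \<Rightarrow> real"
  assumes F [measurable]: "F \<in> borel_measurable M"
    and B: "\<And>x. x \<in> space M \<Longrightarrow> \<bar>F x\<bar> \<le> B"
    and U [measurable]: "U \<in> borel_measurable M"
    and U0: "\<And>x. x \<in> space M \<Longrightarrow> 0 \<le> U x"
    and iU: "integrable M (\<lambda>x. exp (U x))"
  shows "integrable M (\<lambda>x. U x * exp (F x))"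
    and "expectation (\<lambda>x. U x * exp (F x))
           \<le> Ent M (\<lambda>x. exp (F x))
              + expectation (\<lambda>x. exp (F x)) * ln (expectation (\<lambda>x. exp (U x)))"
proof -
  let ?\<phi> = "expectation (\<lambda>x. exp (F x))" and ?Z = "expectation (\<lambda>x. exp (U x))"
  have iF: "integrable M (\<lambda>x. exp (F x))"
    using B by (intro integrable_exp_bounded) auto
  have \<phi>: "0 < ?\<phi>" and Z: "0 < ?Z"
    using expectation_exp_pos iF iU by auto
  show i1: "integrable M (\<lambda>x. U x * exp (F x))"
  proof (rule Bochner_Integration.integrable_bound)
    show "integrable M (\<lambda>x. exp (U x) * exp B)"
      using iU by simp
    show "AE x in M. norm (U x * exp (F x)) \<le> norm (exp (U x) * exp B)"
    proof (rule AE_I2)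
      fix x assume x: "x \<in> space M"
      have "\<bar>U x\<bar> \<le> exp (U x)"
        using U0[OF x] exp_ge_add_one_self[of "U x"] by linarith
      then show "norm (U x * exp (F x)) \<le> norm (exp (U x) * exp B)"
        unfolding norm_mult using B[OF x] by (intro mult_mono) auto
    qed
  qed measurable
  have i2: "integrable M (\<lambda>x. exp (F x) * F x)"
  proof (rule integrable_bounded)
    show "\<bar>exp (F x) * F x\<bar> \<le> exp B * B" if "x \<in> space M" for x
      unfolding abs_mult using B[OF that] by (intro mult_mono) auto
  qed measurable
  have "expectation (\<lambda>x. U x * exp (F x) - ln ?Z * exp (F x))
      \<le> expectation (\<lambda>x. exp (F x) * F x - ln ?\<phi> * exp (F x) - exp (F x) + ?\<phi> / ?Z * exp (U x))"
  proof (rule integral_mono)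
    fix x
    \<comment> \<open>\<open>w\<close> is the logarithm of the ratio of the normalised densities
      \<open>exp U / ?Z\<close> and \<open>exp F / ?\<phi>\<close>. After integration the terms
      \<open>- exp F\<close> and \<open>?\<phi> / ?Z * exp U\<close> cancel, and the entropy
      remains.\<close>
    define w where "w = U x - ln ?Z - F x + ln ?\<phi>"
    have "exp w = ?\<phi> / ?Z * exp (U x) / exp (F x)"
      unfolding w_def using \<phi> Z by (simp add: exp_add exp_diff)
    then have "exp (F x) * (1 + w) \<le> ?\<phi> / ?Z * exp (U x)"
      using exp_ge_add_one_self[of w] by (metis exp_gt_zero mult.commute pos_le_divide_eq)
    then show "U x * exp (F x) - ln ?Z * exp (F x)
        \<le> exp (F x) * F x - ln ?\<phi> * exp (F x) - exp (F x) + ?\<phi> / ?Z * exp (U x)"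
      unfolding w_def by (simp add: algebra_simps)
  qed (use i1 i2 iF iU in auto)
  then show "expectation (\<lambda>x. U x * exp (F x)) \<le> Ent M (\<lambda>x. exp (F x)) + ?\<phi> * ln ?Z"
    unfolding Ent_def using i1 i2 iF iU Z by (simp add: algebra_simps)
qed

text \<open>With \<open>\<phi> u\<close> the expectation of \<open>exp (u * f x)\<close>, the
  derivative of \<open>ln (\<phi> u) / u\<close> is the entropy of \<open>exp (u * f x)\<close>
  divided by \<open>u^2 * \<phi> u\<close>, hence at most \<open>b\<close>. The quotient tends to
  the expectation of \<open>f\<close> at 0, and its value at 1 is the quantity to be
  bounded.\<close>

lemma mgf_le_of_Ent_le:
  fixes f :: "'a \<Rightarrow> real"
  assumes f [measurable]: "f \<in> borel_measurable M"
    and B: "\<And>x. x \<in> space M \<Longrightarrow> \<bar>f x\<bar> \<le> B"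
    and Ent: "\<And>u. 0 < u \<Longrightarrow> u \<le> 1 \<Longrightarrow>
      Ent M (\<lambda>x. exp (u * f x)) \<le> b * u\<^sup>2 * expectation (\<lambda>x. exp (u * f x))"
  shows "expectation (\<lambda>x. exp (f x)) \<le> exp (expectation f + b)"
proof -
  define \<phi> where "\<phi> u = expectation (\<lambda>x. exp (u * f x))" for u
  define \<phi>' where "\<phi>' u = expectation (\<lambda>x. f x * exp (u * f x))" for u
  have pos: "0 < \<phi> u" for u
    unfolding \<phi>_def
    by (intro expectation_exp_pos integrable_exp_bounded[where B = "\<bar>u\<bar> * B"])
      (auto simp: abs_mult intro!: mult_left_mono B)
  have D [derivative_intros]: "(\<phi> has_real_derivative \<phi>' u) (at u)" for u
    unfolding \<phi>_def \<phi>'_def using f B by (rule has_derivative_mgf)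
  \<comment> \<open>Subtracting \<open>b * u\<close> turns the derivative bound into monotonicity.
    The interval starts at \<open>e > 0\<close> because the quotient is not meaningful at 0, which
    is reached by a limit below.\<close>
  have mono: "ln (\<phi> 1) - b \<le> ln (\<phi> e) / e - b * e" if e: "0 < e" "e \<le> 1" for e
  proof -
    have "ln (\<phi> 1) / 1 - b * 1 \<le> ln (\<phi> e) / e - b * e"
    proof (rule DERIV_nonpos_imp_nonincreasing[OF e(2)])
      fix u assume "e \<le> u" "u \<le> 1"
      then have u: "0 < u" "u \<le> 1" using e by auto
      have d: "((\<lambda>u. ln (\<phi> u) / u - b * u) has_real_derivative
          (\<phi>' u / \<phi> u * u - ln (\<phi> u)) / (u * u) - b) (at u)"
        using u pos[of u] by (auto intro!: derivative_eq_intros)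
      have "Ent M (\<lambda>x. exp (u * f x)) = u * \<phi>' u - \<phi> u * ln (\<phi> u)"
        by (simp add: Ent_def \<phi>_def \<phi>'_def mult_ac flip: integral_mult_right_zero)
      then have "u * \<phi>' u - \<phi> u * ln (\<phi> u) \<le> b * u\<^sup>2 * \<phi> u"
        using Ent[OF u] by (simp add: \<phi>_def)
      then have "(\<phi>' u / \<phi> u * u - ln (\<phi> u)) / (u * u) - b \<le> 0"
        using u pos[of u] by (simp add: field_simps power2_eq_square)
      then show "\<exists>y. ((\<lambda>u. ln (\<phi> u) / u - b * u) has_real_derivative y) (at u) \<and> y \<le> 0"
        using d by blast
    qed
    then show ?thesis by simp
  qed
  have \<phi>0: "\<phi> 0 = 1" "\<phi>' 0 = expectation f"
    by (simp_all add: \<phi>_def \<phi>'_def prob_space)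
  \<comment> \<open>As \<open>ln (\<phi> 0) = 0\<close>, the quotient
    \<open>ln (\<phi> u) / u\<close> is the difference quotient of \<open>ln \<phi>\<close> at
    0.\<close>
  have "((\<lambda>u. ln (\<phi> u)) has_real_derivative expectation f) (at 0)"
    using pos[of 0] by (auto intro!: derivative_eq_intros simp: \<phi>0)
  then have "(\<lambda>u. ln (\<phi> u) / u) \<midarrow>0\<rightarrow> expectation f"
    by (simp add: DERIV_def \<phi>0)
  then have "((\<lambda>u. ln (\<phi> u) / u - b * u) \<longlongrightarrow> expectation f - b * 0) (at_right 0)"
    by (intro tendsto_intros) (rule tendsto_mono[OF at_le], auto)
  moreover have "\<forall>\<^sub>F u in at_right 0. ln (\<phi> 1) - b \<le> ln (\<phi> u) / u - b * u"
    using eventually_at_right_real[OF zero_less_one] by eventually_elim (auto intro: mono)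
  ultimately have "ln (\<phi> 1) - b \<le> expectation f - b * 0"
    by (intro tendsto_lowerbound) auto
  then have "ln (\<phi> 1) \<le> expectation f + b" by simp
  then have "\<phi> 1 \<le> exp (expectation f + b)"
    using pos[of 1] by (metis exp_le_cancel_iff exp_ln)
  then show ?thesis
    by (simp add: \<phi>_def)
qed

text \<open>Homogeneity gives the mLSI for \<open>u * f\<close> a factor \<open>u^2\<close>, and
  duality bounds its right-hand side by \<open>u^2 / 2 * (?E + ?\<phi> * ln ?Z)\<close>. Absorbing
  the entropy for \<open>u \<le> 1\<close> yields the hypothesis of \<open>mgf_le_of_Ent_le\<close>
  with \<open>b = ln ?Z\<close>.\<close>

lemma mLSI_imp_mgf_le:
  fixes f g :: "'a \<Rightarrow> real"
  assumes diff: "difference_operator M \<A> \<Gamma>" and \<rho>: "0 < \<rho>" and mLSI: "mLSI M \<A> \<Gamma> \<rho>"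
    and fA: "f \<in> \<A>"
    and g [measurable]: "g \<in> borel_measurable M"
    and le: "\<And>x. x \<in> space M \<Longrightarrow> \<Gamma> f x \<le> g x"
    and int: "integrable M (\<lambda>x. exp (\<rho> * (g x)\<^sup>2))"
  shows "expectation (\<lambda>x. exp (f x)) \<le> exp (expectation f) * expectation (\<lambda>x. exp (\<rho> * (g x)\<^sup>2))"
proof -
  let ?Z = "expectation (\<lambda>x. exp (\<rho> * (g x)\<^sup>2))"
  have f [measurable]: "f \<in> borel_measurable M" and bd: "bounded (f ` space M)"
    and \<Gamma>0: "\<And>x. x \<in> space M \<Longrightarrow> 0 \<le> \<Gamma> f x"
    using diff fA by (auto simp: difference_operator_def)
  have uA: "(\<lambda>x. u * f x) \<in> \<A>" and \<Gamma>u: "\<And>x. x \<in> space M \<Longrightarrow> \<Gamma> (\<lambda>x. u * f x) x = u * \<Gamma> f x"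
    if "0 \<le> u" for u
  proof -
    have "(\<lambda>x. u * f x + 0) \<in> \<A> \<and> (\<forall>x\<in>space M. \<Gamma> (\<lambda>x. u * f x + 0) x = u * \<Gamma> f x)"
      using diff fA that unfolding difference_operator_def by blast
    then show "(\<lambda>x. u * f x) \<in> \<A>" "\<And>x. x \<in> space M \<Longrightarrow> \<Gamma> (\<lambda>x. u * f x) x = u * \<Gamma> f x"
      by simp_all
  qed
  obtain B where B: "\<And>x. x \<in> space M \<Longrightarrow> \<bar>f x\<bar> \<le> B"
    using bd by (auto simp: bounded_iff)
  have Z: "1 \<le> ?Z"
  proof -
    have "expectation (\<lambda>_. 1) \<le> ?Z"
      using int \<rho> by (intro integral_mono) auto
    then show ?thesis by (simp add: prob_space)
  qed
  have "Ent M (\<lambda>x. exp (u * f x)) \<le> ln ?Z * u\<^sup>2 * expectation (\<lambda>x. exp (u * f x))"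
    if u: "0 < u" "u \<le> 1" for u
  proof -
    let ?\<phi> = "expectation (\<lambda>x. exp (u * f x))" and ?E = "Ent M (\<lambda>x. exp (u * f x))"
    let ?I = "expectation (\<lambda>x. \<rho> * (g x)\<^sup>2 * exp (u * f x))"
    have uB: "\<bar>u * f x\<bar> \<le> u * B" if "x \<in> space M" for x
      using B[OF that] u by (simp add: abs_mult)
    have dual: "integrable M (\<lambda>x. \<rho> * (g x)\<^sup>2 * exp (u * f x))" "?I \<le> ?E + ?\<phi> * ln ?Z"
      using Ent_exp_duality[of "\<lambda>x. u * f x" "u * B" "\<lambda>x. \<rho> * (g x)\<^sup>2"] uB int \<rho> by auto
    have I0: "0 \<le> ?I" using \<rho> by simp
    have "ennreal ?E \<le> ennreal (\<rho> / 2) *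
        (\<integral>\<^sup>+ x. ennreal ((\<Gamma> (\<lambda>x. u * f x) x)\<^sup>2 * exp (u * f x)) \<partial>M)"
      using mLSI uA[of u] u by (auto simp: mLSI_def)
    \<comment> \<open>The factor \<open>u^2 / \<rho>\<close> is split off so that the remaining
      integrand is the one of the duality lemma. Its integrability then leads back from extended to
      real values.\<close>
    also have "\<dots> \<le> ennreal (\<rho> / 2) *
        (\<integral>\<^sup>+ x. ennreal (u\<^sup>2 / \<rho>) * ennreal (\<rho> * (g x)\<^sup>2 * exp (u * f x)) \<partial>M)"
    proof (intro mult_left_mono nn_integral_mono)
      fix x assume x: "x \<in> space M"
      have "(\<Gamma> (\<lambda>x. u * f x) x)\<^sup>2 \<le> u\<^sup>2 * (g x)\<^sup>2"
        using \<Gamma>u[OF _ x, of u] u le[OF x] \<Gamma>0[OF x]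
        by (auto simp: power_mult_distrib intro!: mult_left_mono power_mono)
      then have "(\<Gamma> (\<lambda>x. u * f x) x)\<^sup>2 * exp (u * f x) \<le> u\<^sup>2 / \<rho> * (\<rho> * (g x)\<^sup>2 * exp (u * f x))"
        using \<rho> by simp
      then show "ennreal ((\<Gamma> (\<lambda>x. u * f x) x)\<^sup>2 * exp (u * f x))
          \<le> ennreal (u\<^sup>2 / \<rho>) * ennreal (\<rho> * (g x)\<^sup>2 * exp (u * f x))"
        using \<rho> by (subst ennreal_mult'[symmetric]) (auto intro!: ennreal_leI)
    qed simp
    also have "\<dots> = ennreal (\<rho> / 2) * (ennreal (u\<^sup>2 / \<rho>) * ennreal ?I)"
      using dual(1) \<rho> by (subst nn_integral_cmult) (auto simp: nn_integral_eq_integral)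
    also have "\<dots> = ennreal (u\<^sup>2 / 2 * ?I)"
      using \<rho> I0 by (simp flip: ennreal_mult')
    finally have "?E \<le> u\<^sup>2 / 2 * ?I"
      using I0 by (subst (asm) ennreal_le_iff) auto
    also have "\<dots> \<le> u\<^sup>2 / 2 * (?E + ?\<phi> * ln ?Z)"
      using dual(2) by (intro mult_left_mono) auto
    finally have E: "?E \<le> u\<^sup>2 / 2 * (?E + ?\<phi> * ln ?Z)" .
    have nn: "0 \<le> ?\<phi> * ln ?Z" using Z by simp
    have u2: "u\<^sup>2 \<le> 1" using u by (simp add: power_le_one)
    \<comment> \<open>For \<open>?E \<ge> 0\<close> at most half of the entropy appears on the right
      and is moved to the left. For \<open>?E < 0\<close> the claim holds by the sign of the
      right-hand side, so Jensen's inequality is avoided.\<close>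
    show ?thesis
    proof (cases "0 \<le> ?E")
      case True
      have "u\<^sup>2 / 2 * ?E \<le> 1 / 2 * ?E"
        using u2 True by (intro mult_right_mono) auto
      then show ?thesis using E by (simp add: algebra_simps)
    next
      case False
      then show ?thesis
        using mult_nonneg_nonneg[OF nn, of "u\<^sup>2"] by (simp add: algebra_simps)
    qed
  qed
  then have "expectation (\<lambda>x. exp (f x)) \<le> exp (expectation f + ln ?Z)"
    by (intro mgf_le_of_Ent_le[OF f B])
  then show ?thesis
    using Z by (simp add: exp_add)
qed

section \<open>Square-exponential moments from Gaussian tails\<close>

text \<open>Layer-cake formula: \<open>exp (s * W^2)\<close> is 1 plus the integral over
  \<open>[0, W]\<close> of the derivative of \<open>exp (s * t^2)\<close>. After Fubini the tail,
  with rate \<open>4 * s\<close>, beats this growth and leaves the rate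
  \<open>3 * s\<close>.\<close>

lemma expectation_exp_square_le_of_tail:
  fixes g :: "'a \<Rightarrow> real"
  assumes g [measurable]: "g \<in> borel_measurable M" and s: "0 < s" and C: "0 \<le> C"
    and tail: "\<And>t. 0 \<le> t \<Longrightarrow> prob {x \<in> space M. g x \<ge> c + t} \<le> C * exp (- (4 * s * t\<^sup>2))"
  shows "integrable M (\<lambda>x. exp (s * (max 0 (g x - c))\<^sup>2))"
    and "expectation (\<lambda>x. exp (s * (max 0 (g x - c))\<^sup>2)) \<le> 1 + C / 3"
proof -
  \<comment> \<open>\<open>?h\<close> is the derivative of \<open>exp (s * t^2)\<close>, and
    \<open>?k\<close> is \<open>?h\<close> times the Gaussian factor of the tail bound.\<close>
  let ?h = "\<lambda>t::real. 2 * s * t * exp (s * t\<^sup>2)"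
  let ?k = "\<lambda>t::real. 2 * s * t * exp (- (3 * s * t\<^sup>2))"
  have layer: "ennreal (exp (s * (max 0 (g x - c))\<^sup>2))
      = 1 + (\<integral>\<^sup>+ t. ennreal (?h t) * indicator {0..max 0 (g x - c)} t \<partial>lborel)" for x
  proof -
    have "(\<integral>\<^sup>+ t. ennreal (?h t) * indicator {0..max 0 (g x - c)} t \<partial>lborel)
        = ennreal (exp (s * (max 0 (g x - c))\<^sup>2) - exp (s * 0\<^sup>2))"
      using s by (intro nn_integral_FTC_Icc) (auto intro!: derivative_eq_intros)
    then show ?thesis
      using s by (simp flip: ennreal_1 ennreal_plus)
  qed
  have swap: "(\<integral>\<^sup>+ x. (\<integral>\<^sup>+ t. ennreal (?h t) * indicator {0..max 0 (g x - c)} t \<partial>lborel) \<partial>M)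
      = (\<integral>\<^sup>+ t. (\<integral>\<^sup>+ x. ennreal (?h t) * indicator {0..max 0 (g x - c)} t \<partial>M) \<partial>lborel)"
  proof -
    interpret pair_sigma_finite M "lborel :: real measure" ..
    have "(\<lambda>(x, t). ennreal (?h t) * indicator {0..max 0 (g x - c)} t)
        \<in> borel_measurable (M \<Otimes>\<^sub>M lborel)"
      \<comment> \<open>The interval depends on \<open>x\<close>, so joint measurability is read off
        from the inequalities defining membership.\<close>
      unfolding indicator_def atLeastAtMost_iff by measurable
    then show ?thesis by (rule Fubini'[symmetric])
  qed
  have inner: "(\<integral>\<^sup>+ x. ennreal (?h t) * indicator {0..max 0 (g x - c)} t \<partial>M)
      \<le> ennreal C * (ennreal (?k t) * indicator {0..} t)" for t
  \<comment> \<open>For \<open>t > 0\<close>, lying below \<open>max 0 (g x - c)\<close> is the tail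
    event. At \<open>t = 0\<close> the indicator is 1 everywhere, but there \<open>?h\<close>
    vanishes.\<close>
  proof (cases "0 < t")
    case True
    have "(\<integral>\<^sup>+ x. ennreal (?h t) * indicator {0..max 0 (g x - c)} t \<partial>M)
        = (\<integral>\<^sup>+ x. ennreal (?h t) * indicator {x \<in> space M. g x \<ge> c + t} x \<partial>M)"
      using True by (intro nn_integral_cong) (auto simp: indicator_def)
    also have "\<dots> = ennreal (?h t) * ennreal (prob {x \<in> space M. g x \<ge> c + t})"
      by (subst nn_integral_cmult_indicator) (auto simp: emeasure_eq_measure)
    also have "\<dots> \<le> ennreal (?h t) * ennreal (C * exp (- (4 * s * t\<^sup>2)))"
      using tail[of t] True by (intro mult_left_mono ennreal_leI) auto
    also have "\<dots> = ennreal (?h t * (C * exp (- (4 * s * t\<^sup>2))))"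
      using True s by (subst ennreal_mult') auto
    also have "?h t * (C * exp (- (4 * s * t\<^sup>2))) = C * ?k t"
    proof -
      have "exp (s * t\<^sup>2) * exp (- (4 * s * t\<^sup>2)) = exp (- (3 * s * t\<^sup>2))"
        by (subst exp_add[symmetric]) (rule arg_cong[of _ _ exp], simp)
      then show ?thesis by (metis (no_types, opaque_lifting) mult.assoc mult.left_commute)
    qed
    finally show ?thesis
      using True C by (simp add: ennreal_mult')
  next
    case False
    then have "(\<integral>\<^sup>+ x. ennreal (?h t) * indicator {0..max 0 (g x - c)} t \<partial>M) = (\<integral>\<^sup>+ x. 0 \<partial>M)"
      using s by (intro nn_integral_cong) (auto simp: indicator_def)
    then show ?thesis by simp
  qed
  have "(\<integral>\<^sup>+ t. ennreal (?k t) * indicator {0..} t \<partial>lborel)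
      = ennreal (0 - (- (1 / 3) * exp (- (3 * s * 0\<^sup>2))))"
  proof (rule nn_integral_FTC_atLeast)
    \<comment> \<open>This primitive rises from -1/3 at 0 to 0 at infinity, whence the constant
      1/3.\<close>
    show "DERIV (\<lambda>t. - (1 / 3) * exp (- (3 * s * t\<^sup>2))) t :> ?k t" for t
    proof (rule DERIV_cong)
      have "DERIV (\<lambda>t. - (3 * s * t\<^sup>2)) t :> - (6 * s * t)"
        by (auto intro!: derivative_eq_intros)
      then show "DERIV (\<lambda>t. - (1 / 3) * exp (- (3 * s * t\<^sup>2))) t
          :> - (1 / 3) * (exp (- (3 * s * t\<^sup>2)) * - (6 * s * t))"
        by (intro DERIV_cmult DERIV_fun_exp)
      have "- (1 / 3) * (E * - (6 * s * t)) = 2 * s * t * E" for E :: real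
        by simp
      then show "- (1 / 3) * (exp (- (3 * s * t\<^sup>2)) * - (6 * s * t)) = ?k t" .
    qed
    have "LIM t at_top. 3 * s * t\<^sup>2 :> (at_top :: real filter)"
      using s by (intro filterlim_tendsto_pos_mult_at_top[OF tendsto_const] filterlim_pow_at_top filterlim_ident)
        auto
    then have "((\<lambda>t. exp (- (3 * s * t\<^sup>2))) \<longlongrightarrow> 0) at_top"
      unfolding filterlim_uminus_at_top by (rule filterlim_compose[OF exp_at_bot])
    from tendsto_mult_right[OF this, of "- (1 / 3)"]
    show "((\<lambda>t. - (1 / 3) * exp (- (3 * s * t\<^sup>2))) \<longlongrightarrow> 0) at_top" by simp
  qed (use s in auto)
  then have k: "(\<integral>\<^sup>+ t. ennreal (?k t) * indicator {0..} t \<partial>lborel) = ennreal (1 / 3)" by simp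
  have "(\<integral>\<^sup>+ x. ennreal (exp (s * (max 0 (g x - c))\<^sup>2)) \<partial>M)
      = 1 + (\<integral>\<^sup>+ x. (\<integral>\<^sup>+ t. ennreal (?h t) * indicator {0..max 0 (g x - c)} t \<partial>lborel) \<partial>M)"
  proof -
    have "(\<lambda>x. (\<integral>\<^sup>+ t. ennreal (?h t) * indicator {0..max 0 (g x - c)} t \<partial>lborel)) \<in> borel_measurable M"
      unfolding indicator_def atLeastAtMost_iff by measurable
    then show ?thesis
      unfolding layer by (subst nn_integral_add) (auto simp: emeasure_space_1)
  qed
  also have "\<dots> \<le> 1 + (\<integral>\<^sup>+ t. ennreal C * (ennreal (?k t) * indicator {0..} t) \<partial>lborel)"
    unfolding swap using inner by (intro add_left_mono nn_integral_mono)
  also have "\<dots> = 1 + ennreal C * ennreal (1 / 3)"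
    by (subst nn_integral_cmult) (auto simp: k)
  also have "\<dots> = ennreal (1 + C / 3)"
    using C by (simp flip: ennreal_1 ennreal_plus ennreal_mult')
  finally have nn: "(\<integral>\<^sup>+ x. ennreal (exp (s * (max 0 (g x - c))\<^sup>2)) \<partial>M) \<le> ennreal (1 + C / 3)" .
  show int: "integrable M (\<lambda>x. exp (s * (max 0 (g x - c))\<^sup>2))"
  proof (rule integrableI_bounded)
    show "(\<integral>\<^sup>+ x. ennreal (norm (exp (s * (max 0 (g x - c))\<^sup>2))) \<partial>M) < \<infinity>"
      using nn ennreal_less_top[of "1 + C / 3"] by (simp add: order_le_less_trans)
  qed measurable
  show "expectation (\<lambda>x. exp (s * (max 0 (g x - c))\<^sup>2)) \<le> 1 + C / 3"
    using nn C by (subst (asm) nn_integral_eq_integral[OF int]) (auto simp del: ennreal_plus)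
qed

section \<open>Exponential Markov inequality and concentration\<close>

lemma prob_ge_le_mgf:
  fixes X :: "'a \<Rightarrow> real"
  assumes [measurable]: "X \<in> borel_measurable M" and int: "integrable M (\<lambda>x. exp (u * X x))"
    and u: "0 \<le> u"
  shows "prob {x \<in> space M. X x \<ge> t} \<le> exp (- (u * t)) * expectation (\<lambda>x. exp (u * X x))"
proof -
  have "prob {x \<in> space M. X x \<ge> t} = expectation (indicator {x \<in> space M. X x \<ge> t})"
    by simp
  also have "\<dots> \<le> expectation (\<lambda>x. exp (- (u * t)) * exp (u * X x))"
  proof (rule integral_mono)
    fix x
    show "indicator {x \<in> space M. X x \<ge> t} x \<le> exp (- (u * t)) * exp (u * X x)"
      using u by (auto simp: indicator_def mult_left_mono simp flip: exp_add)
  qed (use int in \<open>auto intro!: integrable_real_indicator simp: emeasure_eq_measure\<close>)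
  finally show ?thesis by simp
qed

lemma mLSI_imp_concentration:
  fixes f g :: "'a \<Rightarrow> real"
  assumes diff: "difference_operator M \<A> \<Gamma>" and \<rho>: "0 < \<rho>" and mLSI: "mLSI M \<A> \<Gamma> \<rho>"
    and fA: "f \<in> \<A>"
    and g [measurable]: "g \<in> borel_measurable M"
    and le: "\<And>x. x \<in> space M \<Longrightarrow> \<Gamma> f x \<le> g x"
    and c: "0 < c" and C: "1 \<le> C" and K: "0 < K"
    and tail: "\<And>t. 0 \<le> t \<Longrightarrow> prob {x \<in> space M. g x \<ge> c + t} \<le> C * exp (- (t\<^sup>2 / (2 * K\<^sup>2)))"
    and t: "0 \<le> t"
  shows "prob {x \<in> space M. f x - expectation f \<ge> t}
    \<le> 4 * C / 3 * exp (- (t\<^sup>2 / (8 * (\<rho> * c\<^sup>2 + sqrt \<rho> * K * t))))"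
proof -
  define D where "D = \<rho> * c\<^sup>2 + sqrt \<rho> * K * t"
  \<comment> \<open>The minimiser of \<open>2 * u^2 * D - u * t\<close>, with minimum
    \<open>- (t^2 / (8 * D))\<close>. In \<open>D\<close> the summand with \<open>c\<close> covers
    the Gaussian exponent, and the one with \<open>K\<close> keeps \<open>u\<close> small enough for
    \<open>us\<close>.\<close>
  define u where "u = t / (4 * D)"
  \<comment> \<open>Chosen so that \<open>4 * s = 1 / (2 * K^2)\<close> is the rate of the assumed
    tail.\<close>
  define s where "s = 1 / (8 * K\<^sup>2)"
  define W where "W x = max 0 (g x - c)" for x
  have D: "0 < D" "\<rho> * c\<^sup>2 \<le> D" "sqrt \<rho> * K * t \<le> D"
    unfolding D_def using \<rho> c K t by (auto intro!: add_pos_nonneg)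
  have u: "0 \<le> u" unfolding u_def using t D by simp
  have s: "0 < s" unfolding s_def using K by simp
  \<comment> \<open>Equivalent to \<open>sqrt \<rho> * K * u \<le> 1 / 4\<close> after
    squaring.\<close>
  have us: "2 * \<rho> * u\<^sup>2 \<le> s"
  proof -
    have "sqrt \<rho> * K * u \<le> 1 / 4"
      unfolding u_def using D by (simp add: field_simps)
    then have "(sqrt \<rho> * K * u)\<^sup>2 \<le> (1 / 4)\<^sup>2"
      using \<rho> K u by (intro power_mono) auto
    then have "\<rho> * K\<^sup>2 * u\<^sup>2 \<le> 1 / 16"
      using \<rho> by (simp add: power_mult_distrib power2_eq_square[of "1/4"])
    then show ?thesis
      unfolding s_def using K by (simp add: field_simps)
  qed
  have f [measurable]: "f \<in> borel_measurable M" and bd: "bounded (f ` space M)"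
    and \<Gamma>0: "\<And>x. x \<in> space M \<Longrightarrow> 0 \<le> \<Gamma> f x"
    using diff fA by (auto simp: difference_operator_def)
  obtain B where B: "\<And>x. x \<in> space M \<Longrightarrow> \<bar>f x\<bar> \<le> B"
    using bd by (auto simp: bounded_iff)
  have "(\<lambda>x. u * f x + 0) \<in> \<A> \<and> (\<forall>x\<in>space M. \<Gamma> (\<lambda>x. u * f x + 0) x = u * \<Gamma> f x)"
    using diff fA u unfolding difference_operator_def by blast
  then have uA: "(\<lambda>x. u * f x) \<in> \<A>"
    and \<Gamma>u: "\<And>x. x \<in> space M \<Longrightarrow> \<Gamma> (\<lambda>x. u * f x) x \<le> u * g x"
    using le u by (auto intro: mult_left_mono)
  have W [measurable]: "W \<in> borel_measurable M"
    unfolding W_def by measurable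
  have iW: "integrable M (\<lambda>x. exp (s * (W x)\<^sup>2))"
    and EW: "expectation (\<lambda>x. exp (s * (W x)\<^sup>2)) \<le> 1 + C / 3"
    using expectation_exp_square_le_of_tail[OF g s, of C c] tail C K
    unfolding W_def by (auto simp: s_def field_simps)
  have ptw: "exp (\<rho> * (u * g x)\<^sup>2) \<le> exp (2 * \<rho> * u\<^sup>2 * c\<^sup>2) * exp (s * (W x)\<^sup>2)"
    if x: "x \<in> space M" for x
  proof -
    \<comment> \<open>The bound \<open>g \<le> c + W\<close> may be squared only because
      \<open>g\<close> dominates the non-negative \<open>\<Gamma> f\<close>.\<close>
    have "0 \<le> g x" using \<Gamma>0[OF x] le[OF x] by simp
    moreover have "g x \<le> c + W x" by (simp add: W_def)
    ultimately have "(g x)\<^sup>2 \<le> (c + W x)\<^sup>2" by (rule power_mono[rotated])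
    also have "\<dots> \<le> 2 * c\<^sup>2 + 2 * (W x)\<^sup>2"
      using sum_squares_bound[of c "W x"] by (simp add: power2_sum)
    finally have "\<rho> * u\<^sup>2 * (g x)\<^sup>2 \<le> \<rho> * u\<^sup>2 * (2 * c\<^sup>2 + 2 * (W x)\<^sup>2)"
      using \<rho> by (intro mult_left_mono) auto
    also have "\<dots> = 2 * \<rho> * u\<^sup>2 * c\<^sup>2 + 2 * \<rho> * u\<^sup>2 * (W x)\<^sup>2"
      by (simp add: algebra_simps)
    also have "\<dots> \<le> 2 * \<rho> * u\<^sup>2 * c\<^sup>2 + s * (W x)\<^sup>2"
      using us by (intro add_left_mono mult_right_mono) auto
    finally show ?thesis
      by (simp add: power_mult_distrib mult_ac flip: exp_add)
  qed
  have ig: "integrable M (\<lambda>x. exp (\<rho> * (u * g x)\<^sup>2))"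
  proof (rule Bochner_Integration.integrable_bound)
    show "integrable M (\<lambda>x. exp (2 * \<rho> * u\<^sup>2 * c\<^sup>2) * exp (s * (W x)\<^sup>2))"
      using iW by simp
  qed (use ptw in auto)
  have "expectation (\<lambda>x. exp (\<rho> * (u * g x)\<^sup>2))
      \<le> expectation (\<lambda>x. exp (2 * \<rho> * u\<^sup>2 * c\<^sup>2) * exp (s * (W x)\<^sup>2))"
    using ig iW ptw by (intro integral_mono) auto
  \<comment> \<open>Here \<open>C \<ge> 1\<close> turns \<open>1 + C / 3\<close> into
    \<open>4 * C / 3\<close>.\<close>
  also have "\<dots> \<le> exp (2 * \<rho> * u\<^sup>2 * c\<^sup>2) * (4 * C / 3)"
    using EW C by simp
  finally have Eg: "expectation (\<lambda>x. exp (\<rho> * (u * g x)\<^sup>2)) \<le> exp (2 * \<rho> * u\<^sup>2 * c\<^sup>2) * (4 * C / 3)" .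
  \<comment> \<open>The inequality is applied to \<open>u * f\<close> and \<open>u * g\<close>: the
    scaling by \<open>u\<close> is what secures the exponential integrability of
    \<open>\<rho> * (u * g x)^2\<close>.\<close>
  have "expectation (\<lambda>x. exp (u * f x))
      \<le> exp (u * expectation f) * expectation (\<lambda>x. exp (\<rho> * (u * g x)\<^sup>2))"
    using mLSI_imp_mgf_le[OF diff \<rho> mLSI uA _ \<Gamma>u ig] by simp
  also have "\<dots> \<le> exp (u * expectation f) * (exp (2 * \<rho> * u\<^sup>2 * c\<^sup>2) * (4 * C / 3))"
    using Eg by simp
  finally have mgf: "expectation (\<lambda>x. exp (u * f x))
      \<le> exp (u * expectation f) * (exp (2 * \<rho> * u\<^sup>2 * c\<^sup>2) * (4 * C / 3))" .
  have iuf: "integrable M (\<lambda>x. exp (u * f x))"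
    using B u by (intro integrable_exp_bounded[where B = "u * B"])
      (auto simp: abs_mult intro!: mult_left_mono)
  have "prob {x \<in> space M. f x - expectation f \<ge> t} = prob {x \<in> space M. f x \<ge> expectation f + t}"
    by (simp add: algebra_simps)
  also have "\<dots> \<le> exp (- (u * (expectation f + t))) * expectation (\<lambda>x. exp (u * f x))"
    using f iuf u by (rule prob_ge_le_mgf)
  also have "\<dots> \<le> exp (- (u * (expectation f + t)))
      * (exp (u * expectation f) * (exp (2 * \<rho> * u\<^sup>2 * c\<^sup>2) * (4 * C / 3)))"
    using mgf by (intro mult_left_mono) auto
  also have "\<dots> = 4 * C / 3 * exp (2 * \<rho> * u\<^sup>2 * c\<^sup>2 - u * t)"
  proof -
    have "exp (- (u * (expectation f + t))) * exp (u * expectation f) * exp (2 * \<rho> * u\<^sup>2 * c\<^sup>2)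
        = exp (2 * \<rho> * u\<^sup>2 * c\<^sup>2 - u * t)"
      unfolding exp_add[symmetric] by (rule arg_cong[of _ _ exp]) (simp add: distrib_left)
    then have "4 * C / 3 * exp (2 * \<rho> * u\<^sup>2 * c\<^sup>2 - u * t) = 4 * C / 3 *
        (exp (- (u * (expectation f + t))) * exp (u * expectation f) * exp (2 * \<rho> * u\<^sup>2 * c\<^sup>2))"
      by (rule arg_cong[OF sym])
    then show ?thesis by (simp only: mult_ac)
  qed
  also have "\<dots> \<le> 4 * C / 3 * exp (- (t\<^sup>2 / (8 * D)))"
  proof -
    have "2 * u\<^sup>2 * (\<rho> * c\<^sup>2) \<le> 2 * u\<^sup>2 * D"
      using D by (intro mult_left_mono) auto
    also have "2 * u\<^sup>2 * D = t\<^sup>2 / (8 * D)"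
      unfolding u_def using D by (simp add: field_simps power2_eq_square)
    finally have "2 * u\<^sup>2 * (\<rho> * c\<^sup>2) \<le> t\<^sup>2 / (8 * D)" .
    moreover have "u * t = 2 * (t\<^sup>2 / (8 * D))"
      unfolding u_def using D by (simp add: field_simps power2_eq_square)
    ultimately show ?thesis
      using C by (intro mult_left_mono) (auto simp: mult_ac)
  qed
  finally show ?thesis unfolding D_def .
qed

end

theorem corollary1p4:
  fixes M :: "'a measure"
    and \<A> :: "('a \<Rightarrow> real) set"
    and \<Gamma> :: "('a \<Rightarrow> real) \<Rightarrow> 'a \<Rightarrow> real"
    and f g :: "'a \<Rightarrow> real"
    and \<rho> c C K :: real
  assumes "prob_space M"
    and "difference_operator M \<A> \<Gamma>"
    and "\<rho> > 0"
    and "mLSI M \<A> \<Gamma> \<rho>"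
    and "f \<in> \<A>"
    and "g \<in> borel_measurable M"
    and "\<forall>x\<in>space M. \<Gamma> f x \<le> g x"
    and "c > 0" and "C \<ge> 1" and "K > 0"
    and "\<forall>t\<ge>0. measure M {x \<in> space M. g x \<ge> c + t} \<le> C * exp (- (t\<^sup>2 / (2 * K\<^sup>2)))"
  shows "(\<forall>t\<ge>0. measure M {x \<in> space M. f x - (LINT y|M. f y) \<ge> t}
            \<le> 4 * C / 3 * exp (- (t\<^sup>2 / (8 * (\<rho> * c\<^sup>2 + sqrt \<rho> * K * t)))))
       \<and> ((\<forall>h\<in>\<A>. \<forall>a::real. (\<lambda>x. a * h x) \<in> \<A> \<and>
              (\<forall>x\<in>space M. \<Gamma> (\<lambda>x. a * h x) x = \<bar>a\<bar> * \<Gamma> h x))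
          \<longrightarrow> (\<forall>t\<ge>0. measure M {x \<in> space M. (LINT y|M. f y) - f x \<ge> t}
            \<le> 4 * C / 3 * exp (- (t\<^sup>2 / (8 * (\<rho> * c\<^sup>2 + sqrt \<rho> * K * t))))))"
proof -
  interpret prob_space M by fact
  note bound = mLSI_imp_concentration[OF assms(2-4) _ assms(6) _ assms(8-10)]
  show ?thesis
  proof (intro conjI impI allI)
    fix t :: real assume "0 \<le> t"
    then show "measure M {x \<in> space M. f x - (LINT y|M. f y) \<ge> t}
        \<le> 4 * C / 3 * exp (- (t\<^sup>2 / (8 * (\<rho> * c\<^sup>2 + sqrt \<rho> * K * t))))"
      using assms by (intro bound) auto
  next
    fix t :: real
    assume hom: "\<forall>h\<in>\<A>. \<forall>a::real. (\<lambda>x. a * h x) \<in> \<A> \<and>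
        (\<forall>x\<in>space M. \<Gamma> (\<lambda>x. a * h x) x = \<bar>a\<bar> * \<Gamma> h x)"
      and t: "0 \<le> t"
    \<comment> \<open>At \<open>a = - 1\<close> the factor \<open>\<bar>a\<bar>\<close> is 1, so
      \<open>- f\<close> has the same \<open>\<Gamma>\<close> as \<open>f\<close> and the same
      \<open>g\<close> serves.\<close>
    have A: "(\<lambda>x. - f x) \<in> \<A>" and le: "\<And>x. x \<in> space M \<Longrightarrow> \<Gamma> (\<lambda>x. - f x) x \<le> g x"
      using hom[rule_format, OF assms(5), of "- 1"] assms(7) by auto
    have "measure M {x \<in> space M. - f x - (LINT y|M. - f y) \<ge> t}
        \<le> 4 * C / 3 * exp (- (t\<^sup>2 / (8 * (\<rho> * c\<^sup>2 + sqrt \<rho> * K * t))))"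
      using assms(11) t by (intro bound A le) auto
    then show "measure M {x \<in> space M. (LINT y|M. f y) - f x \<ge> t}
        \<le> 4 * C / 3 * exp (- (t\<^sup>2 / (8 * (\<rho> * c\<^sup>2 + sqrt \<rho> * K * t))))"
      by simp
  qed
qed

end
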